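(* For the wheel graph $W_n$ of order $n\ge5$ and real $k$, $$\dim_f^k(W_n)=k\dim_f(W_n)=\begin{cases}2k & \text{if } n=5 \text{ and } k\in[1,2],\\ \frac{3k}{2} & \text{if } n=6 \text{ and } k\in[1,4],\\ \frac{k(n-1)}{4} & \text{if } n\ge7 \text{ and } k\in[1,4].\end{cases}$$
   Context: The wheel graph $W_n$ of order $n$ is obtained from an $(n-1)$-cycle $C_{n-1}$ by adding one new vertex adjacent to every vertex of $C_{n-1}$. For a finite simple connected graph $G$ with at least two vertices, $d(x,y)$ is the length of a shortest path between $x$ and $y$. For distinct $x,y\in V(G)$, let $R\{x,y\}=\{z\in V(G): d(x,z)\neq d(y,z)\}$, and let $\kappa(G)=\min\{|R\{x,y\}|: x\neq y,\ x,y\in V(G)\}$. For a function $g$ on $V(G)$ and $U\subseteq V(G)$, write $g(U)=\sum_{s\in U}g(s)$. For a real number $k\in[1,\kappa(G)]$, a function $g:V(G)\to[0,1]$ is a $k$-resolving function of $G$ if $g(R\{x,y\})\ge k$ for any two distinct vertices $x,y\in V(G)$; the fractional $k$-metric dimension is $\dim_f^k(G)=\min\{g(V(G)): g \text{ is a } k\text{-resolving function of } G\}$. The fractional metric dimension is $\dim_f(G)=\dim_f^1(G)$. *)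

theory Defs
  imports Complex_Main "Graph_Theory.Graph_Theory"
begin

text \<open>
  Simple graphs are loop-free symmetric digraphs, as in the locales \<open>graph\<close> and \<open>pair_graph\<close>.
  The notions below are meant for finite connected ones with at least two vertices; only then
  are all the minima that occur taken over nonempty sets.
\<close>

definition graph_dist :: "('a, 'b) pre_digraph \<Rightarrow> 'a \<Rightarrow> 'a \<Rightarrow> nat" where
  "graph_dist G x y = (LEAST l. \<exists>p. pre_digraph.apath G x p y \<and> length p = l)"

definition resolving_nbhd :: "('a, 'b) pre_digraph \<Rightarrow> 'a \<Rightarrow> 'a \<Rightarrow> 'a set" where
  "resolving_nbhd G x y = {z \<in> verts G. graph_dist G x z \<noteq> graph_dist G y z}"

definition kappa :: "('a, 'b) pre_digraph \<Rightarrow> nat" where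
  "kappa G = Min {card (resolving_nbhd G x y) | x y. x \<in> verts G \<and> y \<in> verts G \<and> x \<noteq> y}"

text \<open>
  The admissible range \<open>1 \<le> k \<le> kappa G\<close> is part of the notion of a \<open>k\<close>-resolving function.
  For other \<open>k\<close> no function is \<open>k\<close>-resolving and \<open>frac_k_metric_dim k G\<close> is unspecified.
\<close>

definition k_resolving :: "real \<Rightarrow> ('a, 'b) pre_digraph \<Rightarrow> ('a \<Rightarrow> real) \<Rightarrow> bool" where
  "k_resolving k G g \<longleftrightarrow>
     k \<in> {1..real (kappa G)} \<and>
     (\<forall>v \<in> verts G. g v \<in> {0..1}) \<and>
     (\<forall>x \<in> verts G. \<forall>y \<in> verts G. x \<noteq> y \<longrightarrow> (\<Sum>s \<in> resolving_nbhd G x y. g s) \<ge> k)"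

text \<open>
  \<open>LEAST\<close> rather than \<open>Inf\<close>: the value is determined only because the minimum is attained.
\<close>

definition frac_k_metric_dim :: "real \<Rightarrow> ('a, 'b) pre_digraph \<Rightarrow> real" where
  "frac_k_metric_dim k G = (LEAST w. \<exists>g. k_resolving k G g \<and> w = (\<Sum>s \<in> verts G. g s))"

definition frac_metric_dim :: "('a, 'b) pre_digraph \<Rightarrow> real" where
  "frac_metric_dim G = frac_k_metric_dim 1 G"

definition cycle_graph :: "nat \<Rightarrow> nat pair_pre_digraph" where
  "cycle_graph m = \<lparr> pverts = {..<m},
     parcs = {(i, j). i < m \<and> j < m \<and> (j = Suc i mod m \<or> i = Suc j mod m)} \<rparr>"

text \<open>\<open>None\<close> is the new vertex; the old vertices are tagged with \<open>Some\<close>.\<close>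

definition add_universal_vertex :: "'a pair_pre_digraph \<Rightarrow> 'a option pair_pre_digraph" where
  "add_universal_vertex G = \<lparr> pverts = insert None (Some ` pverts G),
     parcs = map_prod Some Some ` parcs G
             \<union> {None} \<times> (Some ` pverts G) \<union> (Some ` pverts G) \<times> {None} \<rparr>"

text \<open>\<open>n\<close> is the order of the wheel, not the length of its rim.\<close>

definition wheel_graph :: "nat \<Rightarrow> nat option pair_pre_digraph" where
  "wheel_graph n = add_universal_vertex (cycle_graph (n - 1))"

lemma pair_graph_wheel_graph:
  assumes "n \<ge> 4"
  shows "pair_graph (wheel_graph n)"
proof
  show "finite (pverts (wheel_graph n))"
    by (simp add: wheel_graph_def add_universal_vertex_def cycle_graph_def)
  have "parcs (wheel_graph n) \<subseteq> pverts (wheel_graph n) \<times> pverts (wheel_graph n)"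
    by (auto simp: wheel_graph_def add_universal_vertex_def cycle_graph_def)
  then show "finite (parcs (wheel_graph n))"
    by (rule finite_subset) (simp add: wheel_graph_def add_universal_vertex_def cycle_graph_def)
  show "symmetric (with_proj (wheel_graph n))"
    by (auto simp: symmetric_def sym_def wheel_graph_def add_universal_vertex_def cycle_graph_def)
  fix e assume e: "e \<in> parcs (wheel_graph n)"
  then show "fst e \<in> pverts (wheel_graph n)" "snd e \<in> pverts (wheel_graph n)"
    by (auto simp: wheel_graph_def add_universal_vertex_def cycle_graph_def)
  have "Suc i mod (n - 1) \<noteq> i" for i
  proof
    assume i: "Suc i mod (n - 1) = i"
    then have "i < n - 1"
      using assms by (metis mod_less_divisor diff_is_0_eq not_gr0 not_numeral_le_zero
        le_trans one_le_numeral numeral_le_one_iff semiring_norm(69))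
    then show False
      using i assms by (cases "Suc i = n - 1") auto
  qed
  then show "fst e \<noteq> snd e"
    using e by (auto simp: wheel_graph_def add_universal_vertex_def cycle_graph_def) metis+
qed

lemma card_pverts_wheel_graph:
  assumes "n \<ge> 1"
  shows "card (pverts (wheel_graph n)) = n"
  using assms
  by (simp add: wheel_graph_def add_universal_vertex_def cycle_graph_def card_image card_insert_if)

lemma connected_wheel_graph:
  assumes "n \<ge> 4"
  shows "connected (with_proj (wheel_graph n))"
proof -
  interpret pair_graph "wheel_graph n"
    using assms by (rule pair_graph_wheel_graph)
  have hub: "None \<in> pverts (wheel_graph n)"
    by (simp add: wheel_graph_def add_universal_vertex_def)
  have to_hub: "v \<rightarrow>\<^sup>*\<^bsub>with_proj (wheel_graph n)\<^esub> None"
    and from_hub: "None \<rightarrow>\<^sup>*\<^bsub>with_proj (wheel_graph n)\<^esub> v"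
    if v: "v \<in> pverts (wheel_graph n)" for v
  proof -
    have "v = None \<or> (v, None) \<in> parcs (wheel_graph n) \<and> (None, v) \<in> parcs (wheel_graph n)"
      using v by (auto simp: wheel_graph_def add_universal_vertex_def)
    then show "v \<rightarrow>\<^sup>*\<^bsub>with_proj (wheel_graph n)\<^esub> None" "None \<rightarrow>\<^sup>*\<^bsub>with_proj (wheel_graph n)\<^esub> v"
      using hub by (auto intro: reachable_adjI)
  qed
  have "u \<rightarrow>\<^sup>*\<^bsub>with_proj (wheel_graph n)\<^esub> v"
    if "u \<in> pverts (wheel_graph n)" "v \<in> pverts (wheel_graph n)" for u v
    using to_hub[OF that(1)] from_hub[OF that(2)] by (rule reachable_trans)
  then show ?thesis
    using hub by (auto simp: connected_def strongly_connected_def intro: reachable_mk_symmetricI)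
qed

end

theory Submission
  imports Defs
begin

text \<open>
  Let \<open>m = n - 1\<close> be the length of the rim and \<open>s\<close> the rotation of the rim by one step. The wheel
  has diameter two, so \<open>R{x,y}\<close> can be read off the neighbourhoods: for two rim vertices
  it is \<open>{x,y} \<union> (N(x) \<triangle> N(y))\<close> and lies in the rim, and for the hub and a rim vertex \<open>i\<close> it is
  everything except the two rim neighbours of \<open>i\<close>.

  For \<open>m \<ge> 5\<close> every \<open>R{i,j}\<close> with \<open>i, j\<close> on the rim has at least four elements, with
  equality for \<open>R{i,s i} = {p i, i, s i, s (s i)}\<close>, where \<open>p\<close> is the inverse of \<open>s\<close>. Summing
  the latter over \<open>i\<close> shows that a \<open>k\<close>-resolving function has weight at least \<open>k m / 4\<close> on the
  rim, and the constant \<open>k / 4\<close> on the rim is \<open>k\<close>-resolving as soon as \<open>m - 2 \<ge> 4\<close>.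
  For \<open>m = 5\<close> the pairs of the hub and a rim vertex have too little weight on the rim, and summing
  over them too forces the extra weight \<open>k / 4\<close> of the hub. For \<open>m = 4\<close> the two antipodal pairs
  partition the rim.
\<close>

section \<open>Distances 0, 1 and 2 in a digraph\<close>

lemma graph_dist_self:
  assumes "x \<in> verts G"
  shows "graph_dist G x x = 0"
proof -
  have "pre_digraph.apath G x [] x"
    using assms by (simp add: pre_digraph.apath_def pre_digraph.awalk_def pre_digraph.cas.simps
        pre_digraph.awalk_verts.simps)
  then show ?thesis
    by (auto simp: graph_dist_def intro!: Least_eq_0)
qed

context wf_digraph
begin

lemma graph_dist_adjacent:
  assumes "x \<noteq> y" and "x \<rightarrow> y"
  shows "graph_dist G x y = 1"
proof -
  obtain e where "e \<in> arcs G" "tail G e = x" "head G e = y"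
    using assms(2) by (auto simp: arcs_ends_def arc_to_ends_def)
  then have "apath x [e] y"
    using assms(1) by (auto simp: apath_def awalk_def)
  moreover have "1 \<le> l" if "\<exists>p. apath x p y \<and> length p = l" for l
    using that assms(1) by (cases l) (auto simp: apath_def awalk_def)
  ultimately show ?thesis
    unfolding graph_dist_def by (intro Least_equality exI[of _ "[e]"]) auto
qed

text \<open>Walks of length 0 and 1 are excluded by \<open>x \<noteq> y\<close> and nonadjacency.
  That \<open>z\<close> differs from both ends makes the walk through it free of repeated vertices,
  as \<open>apath\<close> demands.\<close>

lemma graph_dist_eq_2:
  assumes "x \<noteq> y" and "\<not> x \<rightarrow> y" and "x \<noteq> z" "x \<rightarrow> z" and "z \<noteq> y" "z \<rightarrow> y"
  shows "graph_dist G x y = 2"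
proof -
  obtain e f where "e \<in> arcs G" "tail G e = x" "head G e = z"
    and "f \<in> arcs G" "tail G f = z" "head G f = y"
    using assms(4,6) by (auto simp: arcs_ends_def arc_to_ends_def)
  then have "apath x [e, f] y"
    using assms by (auto simp: apath_def awalk_def)
  moreover have "2 \<le> l" if l: "\<exists>p. apath x p y \<and> length p = l" for l
  proof (rule ccontr)
    obtain p where p: "apath x p y" "length p = l"
      using l by blast
    assume "\<not> 2 \<le> l"
    then consider "p = []" | a where "p = [a]"
      using p(2) by (cases p; cases "tl p") auto
    then show False
    proof cases
      case 1
      then show False using p(1) assms(1) by (simp add: apath_def awalk_def)
    next
      case 2
      then have "x \<rightarrow> y"
        using p(1) by (auto simp: apath_def awalk_def arcs_ends_def arc_to_ends_def)
      then show False using assms(2) by simp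
    qed
  qed
  ultimately show ?thesis
    unfolding graph_dist_def by (intro Least_equality exI[of _ "[e, f]"]) auto
qed

end

section \<open>Rotation of the rim\<close>

definition rot :: "nat \<Rightarrow> nat \<Rightarrow> nat" where
  "rot m i = Suc i mod m"

text \<open>Adding \<open>m\<close> before subtracting keeps truncated subtraction from sending 0 to
  0.\<close>

definition rotinv :: "nat \<Rightarrow> nat \<Rightarrow> nat" where
  "rotinv m i = (i + m - 1) mod m"

lemma rot_if: "i < m \<Longrightarrow> rot m i = (if Suc i = m then 0 else Suc i)"
  by (auto simp: rot_def)

lemma rotinv_if: "i < m \<Longrightarrow> rotinv m i = (if i = 0 then m - 1 else i - 1)"
  by (auto simp: rotinv_def mod_if)

lemma rot_less [simp]: "i < m \<Longrightarrow> rot m i < m"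
  and rotinv_less [simp]: "i < m \<Longrightarrow> rotinv m i < m"
  by (auto simp: rot_def rotinv_def)

lemma rot_rotinv [simp]: "i < m \<Longrightarrow> rot m (rotinv m i) = i"
  and rotinv_rot [simp]: "i < m \<Longrightarrow> rotinv m (rot m i) = i"
  by (auto simp: rot_if rotinv_if)

lemma bij_betw_rot: "bij_betw (rot m) {..<m} {..<m}"
  by (rule bij_betw_byWitness[where f' = "rotinv m"]) auto

lemma bij_betw_rotinv: "bij_betw (rotinv m) {..<m} {..<m}"
  by (rule bij_betw_byWitness[where f' = "rot m"]) auto

text \<open>Rotation by t steps fixes a vertex only if m divides t, which 0 < t < m forbids. All
  later distinctness claims reduce to these four cases.\<close>

lemma rot_ne: "i < m \<Longrightarrow> m \<ge> 2 \<Longrightarrow> rot m i \<noteq> i"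
  and rot2_ne: "i < m \<Longrightarrow> m \<ge> 3 \<Longrightarrow> rot m (rot m i) \<noteq> i"
  and rot3_ne: "i < m \<Longrightarrow> m \<ge> 4 \<Longrightarrow> rot m (rot m (rot m i)) \<noteq> i"
  and rot4_ne: "i < m \<Longrightarrow> m \<ge> 5 \<Longrightarrow> rot m (rot m (rot m (rot m i))) \<noteq> i"
  by (auto simp: rot_if)

lemma rotinv_eq_iff: "i < m \<Longrightarrow> j < m \<Longrightarrow> rotinv m i = j \<longleftrightarrow> i = rot m j"
  by auto

section \<open>Distances and resolving sets in the wheel\<close>

definition rim_adj :: "nat \<Rightarrow> nat \<Rightarrow> nat \<Rightarrow> bool" where
  "rim_adj m i j \<longleftrightarrow> j = rot m i \<or> i = rot m j"

lemma pverts_wheel_graph: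
  "pverts (wheel_graph (Suc m)) = insert None (Some ` {..<m})"
  by (simp add: wheel_graph_def add_universal_vertex_def cycle_graph_def)

lemma parcs_wheel_graph:
  "(None, None) \<notin> parcs (wheel_graph (Suc m))"
  "(None, Some i) \<in> parcs (wheel_graph (Suc m)) \<longleftrightarrow> i < m"
  "(Some i, None) \<in> parcs (wheel_graph (Suc m)) \<longleftrightarrow> i < m"
  "(Some i, Some j) \<in> parcs (wheel_graph (Suc m)) \<longleftrightarrow> i < m \<and> j < m \<and> rim_adj m i j"
  by (auto simp: wheel_graph_def add_universal_vertex_def cycle_graph_def rim_adj_def rot_def
      map_prod_def)

text \<open>Distinct nonadjacent vertices both lie on the rim, so the hub is a common
  neighbour.\<close>

lemma graph_dist_wheel:
  assumes "m \<ge> 3" and "x \<in> pverts (wheel_graph (Suc m))" "y \<in> pverts (wheel_graph (Suc m))"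
  shows "graph_dist (wheel_graph (Suc m)) x y =
    (if x = y then 0 else if (x, y) \<in> parcs (wheel_graph (Suc m)) then 1 else 2)"
proof -
  interpret pair_graph "wheel_graph (Suc m)"
    using assms(1) by (intro pair_graph_wheel_graph) simp
  show ?thesis
  proof (cases "x = y \<or> (x, y) \<in> parcs (wheel_graph (Suc m))")
    case True
    then show ?thesis
      using graph_dist_self[of x "with_proj (wheel_graph (Suc m))"] assms(2)
        graph_dist_adjacent[of x y] by auto
  next
    case False
    then obtain i j where "x = Some i" "y = Some j" "i < m" "j < m"
      using assms(2,3) by (auto simp: pverts_wheel_graph parcs_wheel_graph)
    then show ?thesis
      using False graph_dist_eq_2[of x y None] by (auto simp: parcs_wheel_graph)
  qed
qed

lemma resolving_nbhd_commute: "resolving_nbhd G x y = resolving_nbhd G y x"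
  by (auto simp: resolving_nbhd_def)

text \<open>The hub is missing because it is at distance 1 from both vertices. The disjuncts
  \<open>z = i\<close> and \<open>z = j\<close> record distance 0, which adjacency does not see when
  \<open>i\<close> and \<open>j\<close> are nonadjacent.\<close>

definition rim_res :: "nat \<Rightarrow> nat \<Rightarrow> nat \<Rightarrow> nat set" where
  "rim_res m i j = {z. z < m \<and> (z = i \<or> z = j \<or> rim_adj m i z \<noteq> rim_adj m j z)}"

lemma finite_rim_res [simp]: "finite (rim_res m i j)"
  by (simp add: rim_res_def)

lemma resolving_nbhd_rim:
  assumes "m \<ge> 3" "i < m" "j < m" "i \<noteq> j"
  shows "resolving_nbhd (wheel_graph (Suc m)) (Some i) (Some j) = Some ` rim_res m i j"
  using assms
  by (auto simp: resolving_nbhd_def graph_dist_wheel pverts_wheel_graph parcs_wheel_graph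
      rim_res_def split: if_splits)

text \<open>All rim vertices are at distance 1 from the hub, so exactly those at distance 1 from
  \<open>i\<close> fail to separate the pair.\<close>

lemma resolving_nbhd_hub:
  assumes "m \<ge> 3" "i < m"
  shows "resolving_nbhd (wheel_graph (Suc m)) None (Some i) =
    insert None (Some ` ({..<m} - {rot m i, rotinv m i}))"
proof -
  have "rim_adj m i z \<longleftrightarrow> z = rot m i \<or> z = rotinv m i" if "z < m" for z
    using assms that rotinv_eq_iff[of i m z] by (auto simp: rim_adj_def)
  then show ?thesis
    \<comment> \<open>The vertex \<open>i\<close> itself resolves the pair, so it must differ from
      both of its neighbours.\<close>
    using assms rot_ne[of i m] rot_ne[of "rotinv m i" m]
    by (auto simp: resolving_nbhd_def graph_dist_wheel pverts_wheel_graph parcs_wheel_graph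
        split: if_splits)
qed

lemma sum_resolving_nbhd_rim:
  assumes "m \<ge> 3" "i < m" "j < m" "i \<noteq> j"
  shows "sum g (resolving_nbhd (wheel_graph (Suc m)) (Some i) (Some j)) =
    (\<Sum>z\<in>rim_res m i j. g (Some z))"
  using assms by (simp add: resolving_nbhd_rim sum.reindex)

lemma sum_resolving_nbhd_hub:
  fixes g :: "nat option \<Rightarrow> real"
  assumes "m \<ge> 3" "i < m"
  shows "sum g (resolving_nbhd (wheel_graph (Suc m)) None (Some i)) =
    g None + (\<Sum>z<m. g (Some z)) - g (Some (rot m i)) - g (Some (rotinv m i))"
proof -
  \<comment> \<open>Only for distinct neighbours is each weight subtracted once.\<close>
  have "rot m i \<noteq> rotinv m i"
    using assms rot2_ne[of "rotinv m i" m] by auto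
  then have "(\<Sum>z\<in>{..<m} - {rot m i, rotinv m i}. g (Some z)) =
      (\<Sum>z<m. g (Some z)) - g (Some (rot m i)) - g (Some (rotinv m i))"
    using assms by (subst sum_diff) auto
  then show ?thesis
    using assms by (simp add: resolving_nbhd_hub sum.reindex)
qed

lemma sum_pverts_wheel_graph:
  "sum g (pverts (wheel_graph (Suc m))) = g None + (\<Sum>z<m. g (Some z))"
  by (simp add: pverts_wheel_graph sum.reindex)

section \<open>Sizes of the resolving sets of rim pairs\<close>

lemma rim_res_rot:
  assumes "m \<ge> 5" "i < m"
  shows "rim_res m i (rot m i) = {rotinv m i, i, rot m i, rot m (rot m i)}"
    and "distinct [rotinv m i, i, rot m i, rot m (rot m i)]"
proof -
  let ?a = "rotinv m i"
  have a: "?a < m" and i: "i = rot m ?a"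
    using assms by auto
  show "distinct [rotinv m i, i, rot m i, rot m (rot m i)]"
    \<comment> \<open>Counted from the predecessor \<open>?a\<close>, the four vertices are
      consecutive, so the six inequalities are rotations by one, two or three steps.\<close>
    using assms a i rot_ne[of ?a m] rot2_ne[of ?a m] rot3_ne[of ?a m]
      rot_ne[of i m] rot2_ne[of i m] rot_ne[of "rot m i" m] by auto
  have inj: "rot m u = rot m v \<longleftrightarrow> u = v" if "u < m" "v < m" for u v
    using that by (metis rotinv_rot)
  have "z \<in> rim_res m i (rot m i) \<longleftrightarrow> z \<in> {rotinv m i, i, rot m i, rot m (rot m i)}" for z
  proof (cases "z < m")
    case True
    have "rim_adj m i z \<longleftrightarrow> z = rot m i \<or> z = ?a"
      "rim_adj m (rot m i) z \<longleftrightarrow> z = rot m (rot m i) \<or> z = i"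
      using True assms rotinv_eq_iff[of i m z] inj by (auto simp: rim_adj_def)
    then show ?thesis
      using True \<open>distinct _\<close> by (auto simp: rim_res_def)
  next
    case False
    then show ?thesis using assms by (auto simp: rim_res_def)
  qed
  then show "rim_res m i (rot m i) = {rotinv m i, i, rot m i, rot m (rot m i)}"
    by blast
qed

lemma rim_res_commute: "rim_res m i j = rim_res m j i"
  by (auto simp: rim_res_def)

lemma card_rim_res_rot:
  assumes "m \<ge> 5" "i < m"
  shows "card (rim_res m i (rot m i)) = 4"
  using rim_res_rot[OF assms] by auto

lemma card_rim_res_ge_2:
  assumes "i < m" "j < m" "i \<noteq> j"
  shows "card (rim_res m i j) \<ge> 2"
proof -
  have "{i, j} \<subseteq> rim_res m i j"
    using assms by (auto simp: rim_res_def)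
  from card_mono[OF _ this] show ?thesis
    using assms(3) by simp
qed

text \<open>Vertices two steps apart share the vertex between them, but are resolved by themselves
  and by their outer neighbours. Vertices farther apart have no common neighbour, so
  \<open>i\<close>, \<open>j\<close> and both neighbours of \<open>i\<close> resolve them.\<close>

lemma card_rim_res_ge_4:
  assumes m: "m \<ge> 5" and ij: "i < m" "j < m" "i \<noteq> j"
  shows "card (rim_res m i j) \<ge> 4"
proof -
  have inj: "rot m u = rot m v \<longleftrightarrow> u = v" if "u < m" "v < m" for u v
    using that by (metis rotinv_rot)
  note ne = rot_ne rot2_ne rot3_ne rot4_ne
  have two: "card (rim_res m u (rot m (rot m u))) \<ge> 4" if u: "u < m" for u
  proof -
    let ?a = "rotinv m u"
    have a: "?a < m" "rot m ?a = u"
      using u by auto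
    let ?S = "{?a, u, rot m (rot m u), rot m (rot m (rot m u))}"
    have "?a \<noteq> u" "?a \<noteq> rot m (rot m u)" "?a \<noteq> rot m (rot m (rot m u))"
      using m a ne(1,3,4)[of ?a m] by auto
    \<comment> \<open>Four steps must not close up: on a rim of length 4 the outer neighbour of one
      end would also be adjacent to the other end.\<close>
    moreover have "rot m (rot m u) \<noteq> u" "rot m (rot m (rot m u)) \<noteq> u"
      "rot m (rot m (rot m u)) \<noteq> rot m (rot m u)" "rot m (rot m (rot m (rot m u))) \<noteq> u"
      using m u ne(2-4)[of u m] ne(1)[of "rot m (rot m u)" m] by auto
    ultimately have "card ?S = 4" and "?S \<subseteq> rim_res m u (rot m (rot m u))"
      using m u a inj rot_ne[of u m] rot_ne[of "rot m u" m]
      by (auto simp: rim_res_def rim_adj_def)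
    then show ?thesis
      using card_mono[of "rim_res m u (rot m (rot m u))" ?S] by simp
  qed
  consider "j = rot m i" | "i = rot m j" | "j = rot m (rot m i)" | "i = rot m (rot m j)"
    | "j \<noteq> rot m i" "i \<noteq> rot m j" "j \<noteq> rot m (rot m i)" "i \<noteq> rot m (rot m j)"
    by blast
  then show ?thesis
  proof cases
    case 1
    then show ?thesis using card_rim_res_rot[OF m] ij by simp
  next
    case 2
    then show ?thesis using card_rim_res_rot[OF m] ij rim_res_commute by simp
  next
    case 3
    then show ?thesis using two ij by simp
  next
    case 4
    then show ?thesis using two ij rim_res_commute by simp
  next
    case 5
    let ?a = "rotinv m i"
    have a: "?a < m" "rot m ?a = i"
      using ij by auto
    let ?S = "{?a, i, rot m i, j}"
    have "?a \<noteq> i" "?a \<noteq> rot m i" "?a \<noteq> j" "rot m i \<noteq> i"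
      using m a ij 5 ne(1)[of i m] ne(1,2)[of ?a m] by auto
    moreover have "?a \<noteq> rot m j"
      using a 5 by auto
    ultimately have "card ?S = 4" and "?S \<subseteq> rim_res m i j"
      using m ij a inj 5 by (auto simp: rim_res_def rim_adj_def)
    then show ?thesis
      using card_mono[of "rim_res m i j" ?S] by simp
  qed
qed

text \<open>Antipodal vertices of a 4-cycle have the same two neighbours, so only they themselves
  tell them apart.\<close>

lemma rim_res_4: "rim_res 4 0 2 = {0, 2}" "rim_res 4 1 3 = {1, 3}"
proof -
  have "(z \<in> rim_res 4 0 2 \<longleftrightarrow> z \<in> {0, 2}) \<and> (z \<in> rim_res 4 1 3 \<longleftrightarrow> z \<in> {1, 3})" for z
  proof -
    consider "z = 0" | "z = 1" | "z = 2" | "z = 3" | "z \<ge> 4"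
      by linarith
    then show ?thesis
      by cases (simp_all add: rim_res_def rim_adj_def rot_def)
  qed
  then show "rim_res 4 0 2 = {0, 2}" "rim_res 4 1 3 = {1, 3}"
    by blast+
qed

section \<open>The value of \<open>kappa\<close> for wheels\<close>

lemma kappa_wheel_eqI:
  assumes m: "m \<ge> 3"
    and rim: "\<And>i j. i < m \<Longrightarrow> j < m \<Longrightarrow> i \<noteq> j \<Longrightarrow> c \<le> card (rim_res m i j)"
    and hub: "c \<le> m - 1"
    and att: "a < m" "b < m" "a \<noteq> b" "card (rim_res m a b) = c"
  shows "kappa (wheel_graph (Suc m)) = c"
proof -
  let ?G = "wheel_graph (Suc m)"
  let ?C = "{card (resolving_nbhd ?G x y) | x y. x \<in> verts ?G \<and> y \<in> verts ?G \<and> x \<noteq> y}"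
  have crim: "card (resolving_nbhd ?G (Some i) (Some j)) = card (rim_res m i j)"
    if "i < m" "j < m" "i \<noteq> j" for i j
    using that m by (simp add: resolving_nbhd_rim card_image)
  have chub: "card (resolving_nbhd ?G None (Some i)) = m - 1" if "i < m" for i
  proof -
    have "rot m i \<noteq> rotinv m i"
      using m that rot2_ne[of "rotinv m i" m] by auto
    then have "card ({..<m} - {rot m i, rotinv m i}) = m - 2"
      using that by (subst card_Diff_subset) auto
    then show ?thesis
      using that m by (simp add: resolving_nbhd_hub card_image card_insert_if)
  qed
  then have chub': "card (resolving_nbhd ?G (Some i) None) = m - 1" if "i < m" for i
    using that by (simp add: resolving_nbhd_commute)
  \<comment> \<open>Written as an image of a set of pairs, the set is seen to be finite, as
    \<open>Min\<close> requires.\<close>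
  have "?C = (\<lambda>(x, y). card (resolving_nbhd ?G x y)) `
      {(x, y) \<in> pverts ?G \<times> pverts ?G. x \<noteq> y}"
    by auto
  moreover have "finite (pverts ?G \<times> pverts ?G)"
    by (simp add: pverts_wheel_graph)
  ultimately have "finite ?C"
    by (metis (no_types, lifting) finite_imageI finite_subset mem_Collect_eq subsetI
        case_prodE)
  moreover have "c \<le> r" if r_mem: "r \<in> ?C" for r
  proof -
    obtain x y where r: "r = card (resolving_nbhd ?G x y)"
      and xy: "x \<in> pverts ?G" "y \<in> pverts ?G" "x \<noteq> y"
      using r_mem by auto
    show ?thesis
      using xy crim rim chub chub' hub unfolding r
      by (cases x; cases y) (auto simp: pverts_wheel_graph)
  qed
  moreover have "c \<in> ?C"
    using att crim[of a b]
    by (intro CollectI exI[of _ "Some a"] exI[of _ "Some b"]) (auto simp: pverts_wheel_graph)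
  ultimately show ?thesis
    unfolding kappa_def by (rule Min_eqI)
qed

lemma kappa_wheel_4: "kappa (wheel_graph (Suc 4)) = 2"
  by (rule kappa_wheel_eqI[where a = 0 and b = 2]) (auto intro: card_rim_res_ge_2 simp: rim_res_4)

text \<open>Pairs with the hub contribute \<open>m - 1\<close>, which is at least 4 here, so
  neighbours on the rim give the minimum.\<close>

lemma kappa_wheel_ge_5:
  assumes "m \<ge> 5"
  shows "kappa (wheel_graph (Suc m)) = 4"
  using assms rot_ne[of 0 m] rot_less[of 0 m] card_rim_res_rot[of m 0]
  by (intro kappa_wheel_eqI[where a = 0 and b = "rot m 0"]) (auto intro: card_rim_res_ge_4)

section \<open>Constant rim weights and averaged lower bounds\<close>

text \<open>By the rotational symmetry of the wheel, optimal weights can be sought with one value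
  \<open>a\<close> on the rim and one value \<open>h\<close> at the hub. All upper bounds come from
  this form.\<close>

lemma k_resolving_wheel_const:
  fixes a h :: real
  assumes m: "m \<ge> 3" and k: "k \<in> {1..real (kappa (wheel_graph (Suc m)))}"
    and ah: "a \<in> {0..1}" "h \<in> {0..1}"
    and rim: "\<And>i j. i < m \<Longrightarrow> j < m \<Longrightarrow> i \<noteq> j \<Longrightarrow> k \<le> a * card (rim_res m i j)"
    and hub: "k \<le> h + a * (real m - 2)"
  shows "k_resolving k (wheel_graph (Suc m)) (case_option h (\<lambda>_. a))"
proof -
  let ?G = "wheel_graph (Suc m)" and ?g = "case_option h (\<lambda>_. a)"
  have "k \<le> sum ?g (resolving_nbhd ?G (Some i) (Some j))" if "i < m" "j < m" "i \<noteq> j" for i j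
    using that m rim[of i j] by (simp add: sum_resolving_nbhd_rim mult.commute)
  moreover have "k \<le> sum ?g (resolving_nbhd ?G None (Some i))" if "i < m" for i
    using that m hub by (simp add: sum_resolving_nbhd_hub algebra_simps)
  moreover from this have "k \<le> sum ?g (resolving_nbhd ?G (Some i) None)" if "i < m" for i
    using that by (simp add: resolving_nbhd_commute)
  ultimately show ?thesis
    using k ah by (auto simp: k_resolving_def pverts_wheel_graph)
qed

text \<open>The reals are not well-ordered, so \<open>LEAST\<close> is evaluated by exhibiting a
  function that attains the bound.\<close>

lemma frac_k_metric_dim_eqI:
  assumes "k_resolving k G g" "w = (\<Sum>s\<in>verts G. g s)"
    and "\<And>g. k_resolving k G g \<Longrightarrow> w \<le> (\<Sum>s\<in>verts G. g s)"
  shows "frac_k_metric_dim k G = w"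
  unfolding frac_k_metric_dim_def using assms by (intro Least_equality) auto

text \<open>Each rim vertex lies in exactly four of the sets R{i, s i}, so summing over
  \<open>i\<close> counts the rim weight four times.\<close>

lemma k_resolving_rim_weight:
  assumes m: "m \<ge> 5" and g: "k_resolving k (wheel_graph (Suc m)) g"
  shows "k * real m \<le> 4 * (\<Sum>z<m. g (Some z))"
proof -
  let ?G = "wheel_graph (Suc m)" and ?S = "\<lambda>r. \<Sum>i<m. g (Some (r i))"
  have "k \<le> g (Some (rotinv m i)) + g (Some i) + g (Some (rot m i)) + g (Some (rot m (rot m i)))"
    if i: "i < m" for i
  proof -
    have "k \<le> sum g (resolving_nbhd ?G (Some i) (Some (rot m i)))"
      using g i m rot_ne[of i m] by (auto simp: k_resolving_def pverts_wheel_graph)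
    then show ?thesis
      using rim_res_rot[OF m i] i m rot_ne[of i m] by (simp add: sum_resolving_nbhd_rim add.assoc)
  qed
  then have "(\<Sum>i<m. k) \<le> (\<Sum>i<m. g (Some (rotinv m i)) + g (Some i) + g (Some (rot m i))
      + g (Some (rot m (rot m i))))"
    by (intro sum_mono) auto
  also have "\<dots> = ?S (rotinv m) + ?S (\<lambda>i. i) + ?S (rot m) + ?S (\<lambda>i. rot m (rot m i))"
    by (simp add: sum.distrib)
  also have "?S (\<lambda>i. rot m (rot m i)) = ?S (rot m)"
    using sum.reindex_bij_betw[OF bij_betw_rot, of "\<lambda>i. g (Some (rot m i))"] .
  also have "?S (rot m) = ?S (\<lambda>i. i)"
    using sum.reindex_bij_betw[OF bij_betw_rot, of "\<lambda>i. g (Some i)"] .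
  also have "?S (rotinv m) = ?S (\<lambda>i. i)"
    using sum.reindex_bij_betw[OF bij_betw_rotinv, of "\<lambda>i. g (Some i)"] .
  finally show ?thesis
    by (simp add: mult.commute)
qed

text \<open>The hub lies in all \<open>m\<close> sets R{hub, i}, and each rim vertex is missing from
  two of them, those of its neighbours.\<close>

lemma k_resolving_hub_weight:
  assumes m: "m \<ge> 3" and g: "k_resolving k (wheel_graph (Suc m)) g"
  shows "k * real m \<le> real m * g None + (real m - 2) * (\<Sum>z<m. g (Some z))"
proof -
  let ?G = "wheel_graph (Suc m)" and ?S = "\<lambda>r. \<Sum>i<m. g (Some (r i))"
  have "k \<le> g None + ?S (\<lambda>i. i) - g (Some (rot m i)) - g (Some (rotinv m i))"
    if i: "i < m" for i
  proof -
    have "k \<le> sum g (resolving_nbhd ?G None (Some i))"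
      using g i by (auto simp: k_resolving_def pverts_wheel_graph)
    then show ?thesis
      using m i by (simp add: sum_resolving_nbhd_hub)
  qed
  then have "(\<Sum>i<m. k) \<le>
      (\<Sum>i<m. g None + ?S (\<lambda>i. i) - g (Some (rot m i)) - g (Some (rotinv m i)))"
    by (intro sum_mono) auto
  also have "\<dots> = real m * g None + real m * ?S (\<lambda>i. i) - ?S (rot m) - ?S (rotinv m)"
    by (simp add: sum.distrib sum_subtractf distrib_left)
  also have "?S (rot m) = ?S (\<lambda>i. i)"
    using sum.reindex_bij_betw[OF bij_betw_rot, of "\<lambda>i. g (Some i)"] .
  also have "?S (rotinv m) = ?S (\<lambda>i. i)"
    using sum.reindex_bij_betw[OF bij_betw_rotinv, of "\<lambda>i. g (Some i)"] .
  finally show ?thesis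
    by (simp add: algebra_simps)
qed

lemma k_resolving_hub_nonneg:
  "k_resolving k (wheel_graph (Suc m)) g \<Longrightarrow> 0 \<le> g None"
  by (auto simp: k_resolving_def pverts_wheel_graph)

section \<open>The three cases of the formula\<close>

lemma frac_k_metric_dim_wheel_4:
  assumes "k \<in> {1..2}"
  shows "frac_k_metric_dim k (wheel_graph (Suc 4)) = 2 * k"
proof (rule frac_k_metric_dim_eqI)
  \<comment> \<open>Antipodal pairs have only two resolving vertices, hence \<open>k / 2\<close>,
    which is at most 1 as \<open>k\<close> is at most 2. A pair with the hub already receives
    \<open>k\<close> from two rim vertices, so the hub needs no weight.\<close>
  show "k_resolving k (wheel_graph (Suc 4)) (case_option 0 (\<lambda>_. k / 2))"
  proof (rule k_resolving_wheel_const)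
    fix i j :: nat
    assume "i < 4" "j < 4" "i \<noteq> j"
    then have "2 \<le> real (card (rim_res 4 i j))"
      using card_rim_res_ge_2 by fastforce
    then show "k \<le> k / 2 * real (card (rim_res 4 i j))"
      using assms mult_left_mono[of 2 "real (card (rim_res 4 i j))" "k / 2"] by simp
  \<comment> \<open>The simplifier evaluates \<open>Suc 4\<close> in the goal, so the fact about
    \<open>kappa\<close> is normalised in the same way.\<close>
  qed (use assms in \<open>auto simp: kappa_wheel_4[simplified]\<close>)
next
  show "2 * k = (\<Sum>s\<in>verts (wheel_graph (Suc 4)). case_option 0 (\<lambda>_. k / 2) s)"
    using sum_pverts_wheel_graph[of "case_option 0 (\<lambda>_. k / 2)" 4] by simp
next
  fix g
  assume g: "k_resolving k (wheel_graph (Suc 4)) g"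
  have "k \<le> (\<Sum>z\<in>rim_res 4 i j. g (Some z))" if "i < 4" "j < 4" "i \<noteq> j" for i j
  proof -
    have "k \<le> sum g (resolving_nbhd (wheel_graph (Suc 4)) (Some i) (Some j))"
      using g that pverts_wheel_graph[of 4] by (auto simp: k_resolving_def)
    then show ?thesis
      using that sum_resolving_nbhd_rim[of 4 i j g] by simp
  qed
  from this[of 0 2] this[of 1 3]
  have "k \<le> g (Some 0) + g (Some 2)" "k \<le> g (Some 1) + g (Some 3)"
    by (simp_all add: rim_res_4[simplified])
  moreover have "(\<Sum>z<4. g (Some z)) = g (Some 0) + g (Some 1) + g (Some 2) + g (Some 3)"
    by (simp add: eval_nat_numeral)
  ultimately show "2 * k \<le> (\<Sum>s\<in>verts (wheel_graph (Suc 4)). g s)"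
    using k_resolving_hub_nonneg[OF g] sum_pverts_wheel_graph[of g 4] by simp
qed

lemma quarter_rim:
  fixes k :: real
  assumes "m \<ge> 5" "0 \<le> k" "i < m" "j < m" "i \<noteq> j"
  shows "k \<le> k / 4 * real (card (rim_res m i j))"
proof -
  have "4 \<le> real (card (rim_res m i j))"
    using card_rim_res_ge_4[OF assms(1,3-5)] by simp
  then show ?thesis
    using assms(2) mult_left_mono[of 4 "real (card (rim_res m i j))" "k / 4"] by simp
qed

lemma frac_k_metric_dim_wheel_5:
  assumes "k \<in> {1..4}"
  shows "frac_k_metric_dim k (wheel_graph (Suc 5)) = 3 * k / 2"
proof (rule frac_k_metric_dim_eqI)
  \<comment> \<open>A pair with the hub receives only 3k/4 from its three rim vertices; the hub
    supplies the missing k/4.\<close>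
  show "k_resolving k (wheel_graph (Suc 5)) (case_option (k / 4) (\<lambda>_. k / 4))"
    by (rule k_resolving_wheel_const)
      (use assms quarter_rim in \<open>auto simp: kappa_wheel_ge_5[of 5, simplified]\<close>)
next
  show "3 * k / 2 = (\<Sum>s\<in>verts (wheel_graph (Suc 5)). case_option (k / 4) (\<lambda>_. k / 4) s)"
    using sum_pverts_wheel_graph[of "case_option (k / 4) (\<lambda>_. k / 4)" 5] by simp
next
  fix g
  assume "k_resolving k (wheel_graph (Suc 5)) g"
  \<comment> \<open>With S the rim weight, the hub bound divided by 5 gives \<open>g None\<close> +
    3S/5 >= k, and the rim bound gives 2S/5 >= k/2 for the rest.\<close>
  then show "3 * k / 2 \<le> (\<Sum>s\<in>verts (wheel_graph (Suc 5)). g s)"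
    using k_resolving_rim_weight[of 5 k g] k_resolving_hub_weight[of 5 k g]
      sum_pverts_wheel_graph[of g 5] by simp
qed

lemma frac_k_metric_dim_wheel_ge_6:
  assumes m: "m \<ge> 6" and k: "k \<in> {1..4}"
  shows "frac_k_metric_dim k (wheel_graph (Suc m)) = k * real m / 4"
proof (rule frac_k_metric_dim_eqI)
  \<comment> \<open>A pair with the hub has \<open>m - 2\<close> resolving rim vertices, now at
    least four, so hub weight 0 suffices.\<close>
  have "k / 4 * 4 \<le> k / 4 * (real m - 2)"
    using m k by (intro mult_left_mono) auto
  then show "k_resolving k (wheel_graph (Suc m)) (case_option 0 (\<lambda>_. k / 4))"
    by (intro k_resolving_wheel_const) (use m k quarter_rim in \<open>auto simp: kappa_wheel_ge_5\<close>)
next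
  show "k * real m / 4 = (\<Sum>s\<in>verts (wheel_graph (Suc m)). case_option 0 (\<lambda>_. k / 4) s)"
    by (simp add: sum_pverts_wheel_graph)
next
  fix g
  assume g: "k_resolving k (wheel_graph (Suc m)) g"
  then show "k * real m / 4 \<le> (\<Sum>s\<in>verts (wheel_graph (Suc m)). g s)"
    using k_resolving_rim_weight[OF _ g] k_resolving_hub_nonneg[OF g] m
    by (simp add: sum_pverts_wheel_graph)
qed

theorem proposition4p9:
  fixes n :: nat and k :: real
  assumes "n \<ge> 5"
  shows "(k \<in> {1..real (kappa (wheel_graph n))} \<longrightarrow>
            frac_k_metric_dim k (wheel_graph n) = k * frac_metric_dim (wheel_graph n)) \<and>
         (n = 5 \<and> k \<in> {1..2} \<longrightarrow>
            frac_k_metric_dim k (wheel_graph n) = k * frac_metric_dim (wheel_graph n) \<and>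
            k * frac_metric_dim (wheel_graph n) = 2 * k) \<and>
         (n = 6 \<and> k \<in> {1..4} \<longrightarrow>
            frac_k_metric_dim k (wheel_graph n) = k * frac_metric_dim (wheel_graph n) \<and>
            k * frac_metric_dim (wheel_graph n) = 3 * k / 2) \<and>
         (n \<ge> 7 \<and> k \<in> {1..4} \<longrightarrow>
            frac_k_metric_dim k (wheel_graph n) = k * frac_metric_dim (wheel_graph n) \<and>
            k * frac_metric_dim (wheel_graph n) = k * (real n - 1) / 4)"
proof -
  consider "n = 5" | "n = 6" | m where "n = Suc m" "m \<ge> 6"
    using assms by (cases n) (auto, linarith)
  then show ?thesis
  proof cases
    case 1
    \<comment> \<open>The formula at \<open>k = 1\<close> gives \<open>frac_metric_dim\<close>, and
      its linearity in \<open>k\<close> gives the proportionality. The value of \<open>kappa\<close>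
      turns the interval of the first conjunct into the explicit one.\<close>
    have "frac_k_metric_dim 1 (wheel_graph 5) = 2"
      using frac_k_metric_dim_wheel_4[of 1] by simp
    then show ?thesis
      using 1 frac_k_metric_dim_wheel_4[of k] kappa_wheel_4
      by (simp add: frac_metric_dim_def)
  next
    case 2
    have "frac_k_metric_dim 1 (wheel_graph 6) = 3 / 2"
      using frac_k_metric_dim_wheel_5[of 1] by simp
    then show ?thesis
      using 2 frac_k_metric_dim_wheel_5[of k] kappa_wheel_ge_5[of 5]
      \<comment> \<open>The deleted rule would clear the denominator in the fact for
        \<open>k = 1\<close>, which then would no longer rewrite the dimension.\<close>
      by (auto simp: frac_metric_dim_def simp del: eq_divide_eq_numeral1)
  next
    case 3
    have "frac_k_metric_dim 1 (wheel_graph (Suc m)) = real m / 4"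
      using frac_k_metric_dim_wheel_ge_6[OF 3(2), of 1] by simp
    then show ?thesis
      using 3 frac_k_metric_dim_wheel_ge_6[of m k] kappa_wheel_ge_5[of m]
      by (auto simp: frac_metric_dim_def simp del: eq_divide_eq_numeral1)
  qed
qed

end
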